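(* Let $n\ge 2$ and let $\mathcal{S}=\{|\psi_1\rangle,\dots,|\psi_N\rangle\}$ be a set of mutually orthogonal pure product states in $\bigotimes_{k=1}^n\mathbb{C}^{d_k}$, i.e. each $|\psi_i\rangle$ is of the form $\bigotimes_{k=1}^n|\xi_k^{(i)}\rangle$ with $|\xi_k^{(i)}\rangle\in\mathbb{C}^{d_k}$. Then $\mathcal{S}$ admits complete local random authentication (complete LRA).
   Context: An $n$-partite system ($n\ge 2$) has Hilbert space $\bigotimes_{k=1}^n\mathbb{C}^{d_k}$, each tensor factor being held by a different spatially separated party $B_k$. LOCC has its standard meaning: a protocol with finitely many rounds of local quantum measurements by individual parties and classical communication among all of them; a POVM is LOCC-implementable if its outcome statistics are produced by such a protocol (including classical post-processing). For a set $\mathcal{S}=\{|\psi_1\rangle,\dots,|\psi_N\rangle\}$, an unknown element of which is shared by the parties, the question $\mathcal{Q}_i$ is "is the shared state $|\psi_i\rangle$ or not?"; the parties' LOCC protocol may depend on $i$. The question $\mathcal{Q}_i$ can be perfectly answered under LOCC if there is a two-outcome LOCC-implementable POVM $\{M_i^{(0)},M_i^{(1)}\}$ with $\langle\psi_i|M_i^{(1)}|\psi_i\rangle=1$ and $\langle\psi_j|M_i^{(1)}|\psi_j\rangle=0$ for all $j\ne i$. The set $\mathcal{S}$ admits complete LRA if every question $\mathcal{Q}_1,\dots,\mathcal{Q}_N$ can be perfectly answered under LOCC. *)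

theory Defs
  imports "Jordan_Normal_Form.Schur_Decomposition" "HOL-Library.Nonpos_Ints" "HOL-Library.FuncSet"
begin

text \<open>
  The space of an \<open>n\<close>-partite system with local dimensions \<open>d 0, \<dots>, d (n - 1)\<close> is the tensor
  product of the spaces \<open>carrier_vec (d k)\<close>. A vector is given by its coefficients in the
  product basis, which is indexed by the multi-indices \<open>a\<close> with \<open>a k < d k\<close> for \<open>k < n\<close>.
  Coefficients outside this index set are \<open>0\<close>, so that equality of vectors is equality of functions.
\<close>

type_synonym state = "(nat \<Rightarrow> nat) \<Rightarrow> complex"
type_synonym operator = "(nat \<Rightarrow> nat) \<Rightarrow> (nat \<Rightarrow> nat) \<Rightarrow> complex"

definition multi_index :: "nat \<Rightarrow> (nat \<Rightarrow> nat) \<Rightarrow> (nat \<Rightarrow> nat) set" where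
  "multi_index n d = (\<Pi>\<^sub>E k\<in>{..<n}. {..<d k})"

definition state_space :: "nat \<Rightarrow> (nat \<Rightarrow> nat) \<Rightarrow> state set" where
  "state_space n d = {\<phi>. \<forall>a. a \<notin> multi_index n d \<longrightarrow> \<phi> a = 0}"

definition braket :: "nat \<Rightarrow> (nat \<Rightarrow> nat) \<Rightarrow> state \<Rightarrow> state \<Rightarrow> complex" where
  "braket n d \<phi> \<eta> = (\<Sum>a\<in>multi_index n d. cnj (\<phi> a) * \<eta> a)"

definition norm_sq :: "nat \<Rightarrow> (nat \<Rightarrow> nat) \<Rightarrow> state \<Rightarrow> real" where
  "norm_sq n d \<phi> = (\<Sum>a\<in>multi_index n d. (cmod (\<phi> a))\<^sup>2)"

definition pure_state :: "nat \<Rightarrow> (nat \<Rightarrow> nat) \<Rightarrow> state \<Rightarrow> bool" where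
  "pure_state n d \<phi> \<longleftrightarrow> \<phi> \<in> state_space n d \<and> norm_sq n d \<phi> = 1"

definition tensor :: "nat \<Rightarrow> (nat \<Rightarrow> nat) \<Rightarrow> (nat \<Rightarrow> complex vec) \<Rightarrow> state" where
  "tensor n d \<xi> = (\<lambda>a. if a \<in> multi_index n d then \<Prod>k<n. \<xi> k $ a k else 0)"

definition product_state :: "nat \<Rightarrow> (nat \<Rightarrow> nat) \<Rightarrow> state \<Rightarrow> bool" where
  "product_state n d \<phi> \<longleftrightarrow>
     pure_state n d \<phi> \<and> (\<exists>\<xi>. (\<forall>k<n. \<xi> k \<in> carrier_vec (d k)) \<and> \<phi> = tensor n d \<xi>)"

text \<open>The matrix element of an operator \<open>M\<close> between \<open>\<phi>\<close> and \<open>\<eta>\<close>.\<close>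

definition sandwich :: "nat \<Rightarrow> (nat \<Rightarrow> nat) \<Rightarrow> state \<Rightarrow> operator \<Rightarrow> state \<Rightarrow> complex" where
  "sandwich n d \<phi> M \<eta> =
     (\<Sum>a\<in>multi_index n d. \<Sum>b\<in>multi_index n d. cnj (\<phi> a) * M a b * \<eta> b)"

definition povm :: "nat \<Rightarrow> (nat \<Rightarrow> nat) \<Rightarrow> ('o::finite \<Rightarrow> operator) \<Rightarrow> bool" where
  "povm n d M \<longleftrightarrow>
     (\<forall>x. \<forall>\<phi>\<in>state_space n d. sandwich n d \<phi> (M x) \<phi> \<in> \<real>\<^sub>\<ge>\<^sub>0) \<and>
     (\<forall>a\<in>multi_index n d. \<forall>b\<in>multi_index n d. (\<Sum>x\<in>UNIV. M x a b) = (if a = b then 1 else 0))"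

text \<open>
  A protocol is a finite tree. In \<open>Measure k bs\<close>, party \<open>k\<close> performs the local measurement whose
  outcomes are the entries \<open>(K, P)\<close> of \<open>bs\<close>: \<open>K\<close> is the Kraus operator of the outcome and \<open>P\<close> is
  the protocol carried on with after the outcome has been broadcast. Hence who measures next, and
  how, may depend on all previous outcomes. Kraus operators may be rectangular (a party may add or
  discard local ancillas), in which case the local dimension \<open>d k\<close> becomes \<open>dim_row K\<close>.
  A leaf announces a result, which may depend on the whole record of outcomes; this is the classical
  post-processing. Private and shared randomness are included through Kraus operators that are
  multiples of the identity.
\<close>

datatype 'o locc_protocol =
    Output 'o
  | Measure nat "(complex mat \<times> 'o locc_protocol) list"

fun valid_protocol :: "nat \<Rightarrow> (nat \<Rightarrow> nat) \<Rightarrow> 'o locc_protocol \<Rightarrow> bool" where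
  "valid_protocol n d (Output x) \<longleftrightarrow> True"
| "valid_protocol n d (Measure k bs) \<longleftrightarrow>
     k < n \<and>
     (\<forall>(K, P)\<in>set bs. dim_col K = d k \<and> valid_protocol n (d(k := dim_row K)) P) \<and>
     foldr (+) (map (\<lambda>(K, P). mat_adjoint K * K) bs) (0\<^sub>m (d k) (d k)) = 1\<^sub>m (d k)"

text \<open>The action of \<open>K\<close> on tensor factor \<open>k\<close>, with the identity on all other factors.\<close>

definition apply_local ::
    "nat \<Rightarrow> (nat \<Rightarrow> nat) \<Rightarrow> nat \<Rightarrow> complex mat \<Rightarrow> state \<Rightarrow> state" where
  "apply_local n d k K \<phi> =
     (\<lambda>a. if a \<in> multi_index n (d(k := dim_row K))
          then \<Sum>j<d k. K $$ (a k, j) * \<phi> (a(k := j)) else 0)"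

text \<open>
  The probability that the protocol announces \<open>x\<close>. Post-measurement vectors are not renormalised,
  so the squared norm at a leaf is the probability of reaching that leaf.
\<close>

fun outcome_prob ::
    "nat \<Rightarrow> (nat \<Rightarrow> nat) \<Rightarrow> 'o locc_protocol \<Rightarrow> state \<Rightarrow> 'o \<Rightarrow> real" where
  "outcome_prob n d (Output y) \<phi> x = (if x = y then norm_sq n d \<phi> else 0)"
| "outcome_prob n d (Measure k bs) \<phi> x =
     (\<Sum>(K, P)\<leftarrow>bs. outcome_prob n (d(k := dim_row K)) P (apply_local n d k K \<phi>) x)"

definition locc_implementable ::
    "nat \<Rightarrow> (nat \<Rightarrow> nat) \<Rightarrow> ('o::finite \<Rightarrow> operator) \<Rightarrow> bool" where
  "locc_implementable n d M \<longleftrightarrow>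
     povm n d M \<and>
     (\<exists>P. valid_protocol n d P \<and>
        (\<forall>\<phi> x. pure_state n d \<phi> \<longrightarrow>
           sandwich n d \<phi> (M x) \<phi> = of_real (outcome_prob n d P \<phi> x)))"

text \<open>
  Sets of states are given as families \<open>\<psi> 0, \<dots>, \<psi> (N - 1)\<close>. For the question ``is the shared state
  \<open>\<psi> i\<close> or not?'', the outcome \<open>True\<close> means ``yes''.
\<close>

definition perfectly_answerable ::
    "nat \<Rightarrow> (nat \<Rightarrow> nat) \<Rightarrow> nat \<Rightarrow> (nat \<Rightarrow> state) \<Rightarrow> nat \<Rightarrow> bool" where
  "perfectly_answerable n d N \<psi> i \<longleftrightarrow>
     (\<exists>M :: bool \<Rightarrow> operator. locc_implementable n d M \<and>
        sandwich n d (\<psi> i) (M True) (\<psi> i) = 1 \<and>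
        (\<forall>j<N. j \<noteq> i \<longrightarrow> sandwich n d (\<psi> j) (M True) (\<psi> j) = 0))"

definition complete_LRA ::
    "nat \<Rightarrow> (nat \<Rightarrow> nat) \<Rightarrow> nat \<Rightarrow> (nat \<Rightarrow> state) \<Rightarrow> bool" where
  "complete_LRA n d N \<psi> \<longleftrightarrow> (\<forall>i<N. perfectly_answerable n d N \<psi> i)"

end

theory Submission
  imports Defs
begin

text \<open>
  Write the state in question as a tensor product of unit vectors \<open>u k\<close>. Every party \<open>k\<close> in turn
  measures the projection onto \<open>u k\<close> against its complement, and the answer is ``yes'' iff all
  parties find the projection. This implements the POVM consisting of the projection onto the state
  and its complement, which answers the question since the other states are orthogonal.
\<close>

section \<open>Rank-one projections as two-outcome local measurements\<close>

definition proj_mat :: "complex vec \<Rightarrow> complex mat" where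
  "proj_mat v = mat (dim_vec v) (dim_vec v) (\<lambda>(i, j). v $ i * cnj (v $ j))"

lemma proj_mat_carrier [simp]: "proj_mat v \<in> carrier_mat (dim_vec v) (dim_vec v)"
  and dim_row_proj_mat [simp]: "dim_row (proj_mat v) = dim_vec v"
  and dim_col_proj_mat [simp]: "dim_col (proj_mat v) = dim_vec v"
  by (simp_all add: proj_mat_def)

lemma dim_mat_adjoint [simp]:
  "dim_row (mat_adjoint A) = dim_col A" "dim_col (mat_adjoint A) = dim_row A"
  by (simp_all add: mat_adjoint_def)

lemma index_mat_adjoint:
  assumes "i < dim_col A" "j < dim_row A"
  shows "mat_adjoint A $$ (i, j) = conjugate (A $$ (j, i))"
  using assms by (simp add: mat_adjoint_def mat_of_rows_def)

lemma cnj_mult_self: "cnj z * z = of_real ((cmod z)\<^sup>2)"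
  by (metis complex_norm_square mult.commute)

lemma cnj_mult_sum_unit:
  assumes "(\<Sum>j<m. (cmod (f j))\<^sup>2) = 1"
  shows "(\<Sum>j<m. cnj (f j) * f j) = 1"
  unfolding cnj_mult_self of_real_sum[symmetric] assms by simp

text \<open>For a unit vector, \<open>Q\<close> and \<open>I - Q\<close> are self-adjoint
  idempotents, so each term \<open>mat_adjoint K * K\<close> collapses to \<open>K\<close>. This
  supplies the completeness relation demanded by \<open>valid_protocol\<close>.\<close>

lemma proj_mat_measurement:
  assumes "(\<Sum>j<dim_vec v. (cmod (v $ j))\<^sup>2) = 1"
  defines "Q \<equiv> proj_mat v" and "I \<equiv> 1\<^sub>m (dim_vec v)"
  shows "mat_adjoint Q * Q + mat_adjoint (I - Q) * (I - Q) = I"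
proof -
  let ?m = "dim_vec v"
  have Q: "Q \<in> carrier_mat ?m ?m" and I: "I \<in> carrier_mat ?m ?m"
    by (simp_all add: Q_def I_def)
  have adj: "mat_adjoint Q = Q" "mat_adjoint (I - Q) = I - Q"
    by (rule eq_matI; use Q I in \<open>auto simp: index_mat_adjoint\<close>;
        simp add: Q_def I_def proj_mat_def)+
  have QQ: "Q * Q = Q"
  proof (rule eq_matI)
    fix i j assume "i < dim_row Q" "j < dim_col Q"
    then have ij: "i < ?m" "j < ?m" using Q by auto
    have "(Q * Q) $$ (i, j) = (\<Sum>l<?m. v $ i * cnj (v $ l) * (v $ l * cnj (v $ j)))"
      using ij by (simp add: Q_def proj_mat_def scalar_prod_def atLeast0LessThan)
    also have "\<dots> = v $ i * cnj (v $ j) * (\<Sum>l<?m. cnj (v $ l) * v $ l)"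
      by (simp add: sum_distrib_left mult_ac)
    also have "\<dots> = Q $$ (i, j)"
      using cnj_mult_sum_unit[OF assms(1)] ij by (simp add: Q_def proj_mat_def)
    finally show "(Q * Q) $$ (i, j) = Q $$ (i, j)" .
  qed (use Q in auto)
  have "(I - Q) * (I - Q) = I * (I - Q) - Q * (I - Q)"
    using Q I by (intro minus_mult_distrib_mat) auto
  also have "Q * (I - Q) = Q * I - Q * Q"
    using Q I by (intro mult_minus_distrib_mat) auto
  also have "\<dots> = 0\<^sub>m ?m ?m"
    using Q QQ by (simp add: I_def)
  finally have "(I - Q) * (I - Q) = I - Q"
    using Q I by (auto simp: I_def)
  with QQ adj Q I show ?thesis by (auto intro!: eq_matI)
qed

section \<open>Splitting sums over multi-indices\<close>

lemma finite_multi_index [simp]: "finite (multi_index n d)"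
  by (simp add: multi_index_def finite_PiE)

lemma multi_index_upd:
  "a \<in> multi_index n d \<Longrightarrow> k < n \<Longrightarrow> j < d k \<Longrightarrow> a(k := j) \<in> multi_index n d"
  by (auto simp: multi_index_def PiE_iff extensional_def)

lemma multi_index_less: "a \<in> multi_index n d \<Longrightarrow> k < n \<Longrightarrow> a k < d k"
  by (auto simp: multi_index_def PiE_iff)

lemma sum_PiE_insert:
  assumes "k \<notin> A"
  shows "sum f (PiE (insert k A) B) = (\<Sum>r\<in>PiE A B. \<Sum>j\<in>B k. f (r(k := j)))"
proof -
  have "sum f (PiE (insert k A) B) = (\<Sum>(j, r)\<in>B k \<times> PiE A B. f (r(k := j)))"
    unfolding PiE_insert_eq
    by (subst sum.reindex[OF inj_combinator[OF assms]]) (simp add: case_prod_unfold)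
  also have "\<dots> = (\<Sum>r\<in>PiE A B. \<Sum>j\<in>B k. f (r(k := j)))"
    by (subst sum.cartesian_product[symmetric], rule sum.swap)
  finally show ?thesis .
qed

text \<open>Freezing the indices of all other parties reduces claims about a local operation of
  party \<open>k\<close> to claims about single vectors with \<open>d k\<close> entries.\<close>

lemma sum_multi_index_fibre:
  assumes "k < n"
  shows "sum f (multi_index n d) =
    (\<Sum>r\<in>(\<Pi>\<^sub>E i\<in>{..<n} - {k}. {..<d i}). \<Sum>j<d k. f (r(k := j)))"
  using sum_PiE_insert[of k "{..<n} - {k}" f "\<lambda>i. {..<d i}"] assms
  by (simp add: multi_index_def insert_absorb)

lemma sum_multi_index_Suc:
  "sum f (multi_index (Suc m) d) = (\<Sum>r\<in>multi_index m d. \<Sum>j<d m. f (r(m := j)))"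
  using sum_PiE_insert[of m "{..<m}" f "\<lambda>i. {..<d i}"]
  by (simp add: multi_index_def lessThan_Suc)

lemma fibre_upd_multi_index:
  "r \<in> (\<Pi>\<^sub>E i\<in>{..<n} - {k}. {..<d i}) \<Longrightarrow> k < n \<Longrightarrow> j < d k \<Longrightarrow> r(k := j) \<in> multi_index n d"
  by (auto simp: multi_index_def PiE_iff extensional_def)

section \<open>Local projections and conservation of the squared norm\<close>

lemma apply_local_proj_mat:
  assumes "k < n" "dim_vec v = d k" "a \<in> multi_index n d"
  shows "apply_local n d k (proj_mat v) \<phi> a = v $ a k * (\<Sum>j<d k. cnj (v $ j) * \<phi> (a(k := j)))"
  using assms multi_index_less[OF assms(3,1)]
  \<comment> \<open>The matrix is square of size \<open>d k\<close>, so the updated dimension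
    function is \<open>d\<close> again by \<open>fun_upd_idem\<close>.\<close>
  by (simp add: apply_local_def proj_mat_def fun_upd_idem sum_distrib_left mult_ac)

lemma apply_local_one_minus_proj_mat:
  assumes "k < n" "dim_vec v = d k" "a \<in> multi_index n d"
  shows "apply_local n d k (1\<^sub>m (d k) - proj_mat v) \<phi> a =
    \<phi> a - apply_local n d k (proj_mat v) \<phi> a"
proof -
  have k: "a k < d k" using multi_index_less[OF assms(3,1)] .
  have "(\<Sum>j<d k. (1\<^sub>m (d k) - proj_mat v) $$ (a k, j) * \<phi> (a(k := j))) =
    (\<Sum>j<d k. (if j = a k then \<phi> a else 0) - proj_mat v $$ (a k, j) * \<phi> (a(k := j)))"
    using k assms(2) by (intro sum.cong refl) (auto simp: algebra_simps)
  also have "\<dots> = \<phi> a - (\<Sum>j<d k. proj_mat v $$ (a k, j) * \<phi> (a(k := j)))"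
    using k by (simp add: sum_subtractf)
  finally show ?thesis
    using assms by (simp add: apply_local_def fun_upd_idem)
qed

text \<open>The vector \<open>f j * c\<close> is the orthogonal projection of \<open>g\<close> onto
  the line spanned by the unit vector \<open>f\<close>, and \<open>g j - f j * c\<close> is its
  orthogonal remainder.\<close>

lemma pythagoras_unit_vector:
  fixes f g :: "nat \<Rightarrow> complex"
  assumes "(\<Sum>j<m. (cmod (f j))\<^sup>2) = 1"
  defines "c \<equiv> \<Sum>j<m. cnj (f j) * g j"
  shows "(\<Sum>j<m. (cmod (f j * c))\<^sup>2) + (\<Sum>j<m. (cmod (g j - f j * c))\<^sup>2) = (\<Sum>j<m. (cmod (g j))\<^sup>2)"
proof -
  \<comment> \<open>The cross term is kept in the shape \<open>cnj c * (cnj x * y)\<close> because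
    summing over \<open>j\<close> turns its second factor into \<open>c\<close>; it then cancels the
    two copies of the squared modulus of \<open>c\<close>.\<close>
  have pt: "(cmod (x * c))\<^sup>2 + (cmod (y - x * c))\<^sup>2 =
      (cmod y)\<^sup>2 + 2 * (cmod x)\<^sup>2 * (cmod c)\<^sup>2 - 2 * Re (cnj c * (cnj x * y))" for x y
    by (simp add: cmod_power2 norm_mult power_mult_distrib) (simp add: power2_eq_square algebra_simps)
  have "(\<Sum>j<m. (cmod (f j * c))\<^sup>2) + (\<Sum>j<m. (cmod (g j - f j * c))\<^sup>2) =
     (\<Sum>j<m. (cmod (g j))\<^sup>2) + 2 * (\<Sum>j<m. (cmod (f j))\<^sup>2) * (cmod c)\<^sup>2 - 2 * Re (cnj c * c)"
    unfolding sum.distrib[symmetric] pt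
    unfolding sum_subtractf sum.distrib
    by (simp add: c_def sum_distrib_left sum_distrib_right Re_sum mult_ac)
  also have "Re (cnj c * c) = (cmod c)\<^sup>2"
    by (simp only: cnj_mult_self Re_complex_of_real)
  finally show ?thesis using assms(1) by simp
qed

lemma norm_sq_proj_mat_split:
  assumes "k < n" "dim_vec v = d k" "(\<Sum>j<d k. (cmod (v $ j))\<^sup>2) = 1"
  shows "norm_sq n d (apply_local n d k (proj_mat v) \<phi>) +
    norm_sq n d (apply_local n d k (1\<^sub>m (d k) - proj_mat v) \<phi>) = norm_sq n d \<phi>"
proof -
  have "(\<Sum>j<d k. (cmod (apply_local n d k (proj_mat v) \<phi> (r(k := j))))\<^sup>2) +
      (\<Sum>j<d k. (cmod (apply_local n d k (1\<^sub>m (d k) - proj_mat v) \<phi> (r(k := j))))\<^sup>2) =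
      (\<Sum>j<d k. (cmod (\<phi> (r(k := j))))\<^sup>2)"
    if r: "r \<in> (\<Pi>\<^sub>E i\<in>{..<n} - {k}. {..<d i})" for r
    using pythagoras_unit_vector[of "\<lambda>j. v $ j" "d k" "\<lambda>j. \<phi> (r(k := j))"]
      fibre_upd_multi_index[OF r assms(1)] assms
    by (simp add: apply_local_one_minus_proj_mat apply_local_proj_mat)
  then show ?thesis
    unfolding norm_sq_def sum_multi_index_fibre[OF assms(1)] sum.distrib[symmetric]
    by (rule sum.cong[OF refl])
qed

text \<open>Multiplicativity of the norm: the product of sums expands, by
  \<open>prod_sum_PiE\<close>, into a sum over multi-indices.\<close>

lemma norm_sq_tensor:
  "norm_sq n d (tensor n d v) = (\<Prod>k<n. \<Sum>j<d k. (cmod (v k $ j))\<^sup>2)"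
  by (simp add: norm_sq_def tensor_def multi_index_def prod_sum_PiE prod_norm[symmetric]
      flip: prod_power_distrib)

section \<open>The protocol and its outcome probabilities\<close>

fun check_factors :: "(nat \<Rightarrow> complex vec) \<Rightarrow> nat list \<Rightarrow> bool locc_protocol" where
  "check_factors u [] = Output True"
| "check_factors u (k # ks) = Measure k
    [(proj_mat (u k), check_factors u ks),
     (1\<^sub>m (dim_vec (u k)) - proj_mat (u k), Output False)]"

text \<open>The unnormalised state on the branch where every listed party finds its projection;
  \<open>fold\<close> lets the head of the list act first, as in
  \<open>check_factors\<close>.\<close>

definition project_factors ::
    "nat \<Rightarrow> (nat \<Rightarrow> nat) \<Rightarrow> (nat \<Rightarrow> complex vec) \<Rightarrow> nat list \<Rightarrow> state \<Rightarrow> state" where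
  "project_factors n d u = fold (\<lambda>k. apply_local n d k (proj_mat (u k)))"

lemma outcome_prob_nonneg: "outcome_prob n d P \<phi> x \<ge> 0"
proof (induction P arbitrary: d \<phi>)
  case (Output y)
  then show ?case by (simp add: norm_sq_def sum_nonneg)
next
  case (Measure k bs)
  then show ?case by (fastforce intro!: sum_list_nonneg)
qed

context
  fixes n :: nat and d :: "nat \<Rightarrow> nat" and u :: "nat \<Rightarrow> complex vec"
  assumes dim_u: "\<And>k. k < n \<Longrightarrow> dim_vec (u k) = d k"
    and unit_u: "\<And>k. k < n \<Longrightarrow> (\<Sum>j<d k. (cmod (u k $ j))\<^sup>2) = 1"
begin

lemma valid_check_factors: "set ks \<subseteq> {..<n} \<Longrightarrow> valid_protocol n d (check_factors u ks)"
proof (induction ks)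
  case (Cons k ks)
  let ?Q = "proj_mat (u k)" and ?I = "1\<^sub>m (dim_vec (u k))"
  have k: "dim_vec (u k) = d k" using Cons dim_u by auto
  have "mat_adjoint (?I - ?Q) * (?I - ?Q) \<in> carrier_mat (d k) (d k)"
    using k by (auto intro!: carrier_matI)
  then have "mat_adjoint ?Q * ?Q + (mat_adjoint (?I - ?Q) * (?I - ?Q) + 0\<^sub>m (d k) (d k)) = 1\<^sub>m (d k)"
    using proj_mat_measurement[of "u k"] unit_u[of k] k Cons.prems by simp
  with Cons k show ?case by (simp add: fun_upd_idem)
qed simp

lemma outcome_prob_check_factors_True:
  "set ks \<subseteq> {..<n} \<Longrightarrow>
    outcome_prob n d (check_factors u ks) \<phi> True = norm_sq n d (project_factors n d u ks \<phi>)"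
  by (induction ks arbitrary: \<phi>) (simp_all add: project_factors_def dim_u fun_upd_idem)

text \<open>Each measurement splits the squared norm without loss. The probability of
  \<open>False\<close> is thus the complement of that of \<open>True\<close>, and the failing
  branches need no separate evaluation.\<close>

lemma outcome_prob_check_factors_total:
  "set ks \<subseteq> {..<n} \<Longrightarrow>
    outcome_prob n d (check_factors u ks) \<phi> True + outcome_prob n d (check_factors u ks) \<phi> False
      = norm_sq n d \<phi>"
proof (induction ks arbitrary: \<phi>)
  case (Cons k ks)
  have k: "k < n" using Cons.prems by simp
  show ?case
    using Cons.IH[of "apply_local n d k (proj_mat (u k)) \<phi>"] Cons.prems k
      norm_sq_proj_mat_split[of k n "u k" d \<phi>, OF k dim_u[OF k] unit_u[OF k]]
    by (simp add: dim_u fun_upd_idem)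
qed simp

text \<open>The first \<open>m\<close> indices of \<phi> have been contracted with the conjugate
  factors and replaced by the entries of \<open>u\<close>; the later ones are untouched. Since
  \<open>b\<close> is \<open>undefined\<close> from \<open>m\<close> on, those positions are filled
  from \<open>a\<close>.\<close>

lemma project_factors_upt:
  assumes "m \<le> n" "a \<in> multi_index n d"
  shows "project_factors n d u [0..<m] \<phi> a = (\<Prod>k<m. u k $ a k) *
    (\<Sum>b\<in>multi_index m d. (\<Prod>k<m. cnj (u k $ b k)) * \<phi> (\<lambda>k. if k < m then b k else a k))"
  using assms
proof (induction m arbitrary: a)
  case 0
  \<comment> \<open>\<open>multi_index 0 d\<close> is a singleton, so the sum is the single value of
    \<phi> at \<open>a\<close>.\<close>
  then show ?case by (simp add: project_factors_def multi_index_def)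
next
  case (Suc m)
  let ?F = "\<lambda>b j. (\<Prod>k<m. cnj (u k $ b k)) * \<phi> (\<lambda>k. if k < m then b k else (a(m := j)) k)"
  have m: "m < n" and a: "a \<in> multi_index n d" using Suc.prems by auto
  have "project_factors n d u [0..<Suc m] \<phi> a =
      u m $ a m * (\<Sum>j<d m. cnj (u m $ j) * project_factors n d u [0..<m] \<phi> (a(m := j)))"
    using m a by (simp add: project_factors_def apply_local_proj_mat dim_u)
  also have "\<dots> = u m $ a m * (\<Sum>j<d m. cnj (u m $ j) *
      ((\<Prod>k<m. u k $ a k) * (\<Sum>b\<in>multi_index m d. ?F b j)))"
  proof (intro arg_cong[where f = "(*) (u m $ a m)"] sum.cong refl)
    fix j assume "j \<in> {..<d m}"
    then have "a(m := j) \<in> multi_index n d"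
      using a m by (simp add: multi_index_upd)
    moreover have "(\<Prod>k<m. u k $ (a(m := j)) k) = (\<Prod>k<m. u k $ a k)"
      by (intro prod.cong) auto
    ultimately show "cnj (u m $ j) * project_factors n d u [0..<m] \<phi> (a(m := j)) = cnj (u m $ j) *
      ((\<Prod>k<m. u k $ a k) * (\<Sum>b\<in>multi_index m d. ?F b j))"
      using m by (simp add: Suc.IH del: fun_upd_apply)
  qed
  also have "\<dots> = (\<Prod>k<Suc m. u k $ a k) *
      (\<Sum>b\<in>multi_index m d. \<Sum>j<d m. cnj (u m $ j) * ?F b j)"
    \<comment> \<open>Moving the sum over \<open>j\<close> inside lets \<open>b\<close> and
      \<open>j\<close> be merged into one multi-index of \<open>m + 1\<close> parties.\<close>
    by (subst sum.swap) (simp add: sum_distrib_left mult_ac)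
  also have "(\<Sum>b\<in>multi_index m d. \<Sum>j<d m. cnj (u m $ j) * ?F b j) =
      (\<Sum>b\<in>multi_index (Suc m) d.
        (\<Prod>k<Suc m. cnj (u k $ b k)) * \<phi> (\<lambda>k. if k < Suc m then b k else a k))"
    unfolding sum_multi_index_Suc
  proof (intro sum.cong refl)
    fix b j
    have "(\<lambda>k. if k < m then b k else (a(m := j)) k) =
        (\<lambda>k. if k < Suc m then (b(m := j)) k else a k)"
      by (auto simp: fun_eq_iff less_Suc_eq)
    then show "cnj (u m $ j) * ?F b j = (\<Prod>k<Suc m. cnj (u k $ (b(m := j)) k)) *
        \<phi> (\<lambda>k. if k < Suc m then (b(m := j)) k else a k)"
      by (simp add: mult_ac)
  qed
  finally show ?case .
qed

lemma project_factors_all: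
  assumes "a \<in> multi_index n d"
  shows "project_factors n d u [0..<n] \<phi> a = tensor n d u a * braket n d (tensor n d u) \<phi>"
proof -
  \<comment> \<open>Both \<open>a\<close> and \<open>b\<close> are \<open>undefined\<close> from
    \<open>n\<close> on, so no trace of \<open>a\<close> remains.\<close>
  have "(\<lambda>k. if k < n then b k else a k) = b" if "b \<in> multi_index n d" for b
    using that assms by (auto simp: multi_index_def PiE_iff extensional_def fun_eq_iff)
  then show ?thesis
    using project_factors_upt[of n a \<phi>] assms by (simp add: tensor_def braket_def)
qed

text \<open>The Born rule for the projection onto the product vector, valid without normalisation of
  \<phi>.\<close>

lemma outcome_prob_check_all:
  "outcome_prob n d (check_factors u [0..<n]) \<phi> x =
    (if x then (cmod (braket n d (tensor n d u) \<phi>))\<^sup>2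
     else norm_sq n d \<phi> - (cmod (braket n d (tensor n d u) \<phi>))\<^sup>2)"
proof -
  let ?c = "braket n d (tensor n d u) \<phi>"
  have "outcome_prob n d (check_factors u [0..<n]) \<phi> True =
      (\<Sum>a\<in>multi_index n d. (cmod (tensor n d u a * ?c))\<^sup>2)"
    by (subst outcome_prob_check_factors_True) (auto simp: norm_sq_def project_factors_all)
  also have "\<dots> = norm_sq n d (tensor n d u) * (cmod ?c)\<^sup>2"
    by (simp add: norm_sq_def norm_mult power_mult_distrib sum_distrib_right)
  also have "\<dots> = (cmod ?c)\<^sup>2"
    by (simp add: norm_sq_tensor unit_u)
  finally show ?thesis
    using outcome_prob_check_factors_total[of "[0..<n]" \<phi>] by (auto simp: atLeast0LessThan)
qed

end

text \<open>The given factors need not be unit vectors; only the product of their norms is 1.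
  Dividing each by its norm therefore leaves the tensor product unchanged.\<close>

lemma product_state_unit_factors:
  assumes "product_state n d \<phi>"
  obtains u where "\<And>k. k < n \<Longrightarrow> dim_vec (u k) = d k"
    and "\<And>k. k < n \<Longrightarrow> (\<Sum>j<d k. (cmod (u k $ j))\<^sup>2) = 1"
    and "\<phi> = tensor n d u"
proof -
  obtain \<xi> where \<xi>: "\<And>k. k < n \<Longrightarrow> dim_vec (\<xi> k) = d k" "\<phi> = tensor n d \<xi>"
    and "norm_sq n d \<phi> = 1"
    using assms unfolding product_state_def pure_state_def by (metis carrier_vecD)
  define w where "w k = (\<Sum>j<d k. (cmod (\<xi> k $ j))\<^sup>2)" for k
  have w0: "w k \<ge> 0" for k by (simp add: w_def sum_nonneg)
  have w1: "(\<Prod>k<n. w k) = 1"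
    using \<open>norm_sq n d \<phi> = 1\<close> \<xi>(2) by (simp add: norm_sq_tensor w_def)
  \<comment> \<open>A product equal to 1 has no zero factor, so the division is legitimate.\<close>
  have w: "w k > 0" if "k < n" for k
    using w1 that w0[of k] by (metis finite_lessThan lessThan_iff order_less_le prod_zero_iff zero_neq_one)
  define u where "u k = complex_of_real (1 / sqrt (w k)) \<cdot>\<^sub>v \<xi> k" for k
  have u: "u k $ j = \<xi> k $ j / sqrt (w k)" if "k < n" "j < d k" for k j
    using that \<xi>(1) by (simp add: u_def)
  have "(\<Sum>j<d k. (cmod (u k $ j))\<^sup>2) = 1" if "k < n" for k
  proof -
    have "(\<Sum>j<d k. (cmod (u k $ j))\<^sup>2) = (\<Sum>j<d k. (cmod (\<xi> k $ j))\<^sup>2 / w k)"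
      using that w0 by (simp add: u norm_divide power_divide)
    also have "\<dots> = 1" using w[OF that] by (simp add: w_def flip: sum_divide_distrib)
    finally show ?thesis .
  qed
  moreover have "\<phi> = tensor n d u"
  proof
    fix a
    have "(\<Prod>k<m. sqrt (w k)) = sqrt (\<Prod>k<m. w k)" for m
      by (induction m) (simp_all add: real_sqrt_mult)
    then have "(\<Prod>k<n. complex_of_real (sqrt (w k))) = 1"
      using w1 by (simp flip: of_real_prod)
    then show "\<phi> a = tensor n d u a"
      by (auto simp: \<xi>(2) tensor_def u multi_index_less prod_dividef)
  qed
  ultimately show thesis using \<xi>(1) by (intro that[of u]) (simp_all add: u_def)
qed

section \<open>Matrix elements of the POVM and the final answer\<close>

lemma sandwich_rank_one:
  "sandwich n d \<phi> (\<lambda>a b. \<eta> a * cnj (\<eta> b)) \<phi> = of_real ((cmod (braket n d \<eta> \<phi>))\<^sup>2)"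
proof -
  have "sandwich n d \<phi> (\<lambda>a b. \<eta> a * cnj (\<eta> b)) \<phi> = cnj (braket n d \<eta> \<phi>) * braket n d \<eta> \<phi>"
    by (simp add: sandwich_def braket_def sum_product mult_ac)
  then show ?thesis by (simp only: cnj_mult_self)
qed

lemma sandwich_one_minus:
  "sandwich n d \<phi> (\<lambda>a b. (if a = b then 1 else 0) - M a b) \<phi> =
    of_real (norm_sq n d \<phi>) - sandwich n d \<phi> M \<phi>"
proof -
  have "sandwich n d \<phi> (\<lambda>a b. (if a = b then 1 else 0) - M a b) \<phi> =
      (\<Sum>a\<in>multi_index n d. \<Sum>b\<in>multi_index n d. (if a = b then cnj (\<phi> a) * \<phi> a else 0)) -
      sandwich n d \<phi> M \<phi>"
    unfolding sandwich_def sum_subtractf[symmetric]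
    by (intro sum.cong refl) (auto simp: algebra_simps)
  also have "(\<Sum>a\<in>multi_index n d. \<Sum>b\<in>multi_index n d. (if a = b then cnj (\<phi> a) * \<phi> a else 0)) =
      (\<Sum>a\<in>multi_index n d. cnj (\<phi> a) * \<phi> a)"
    by (intro sum.cong refl) simp
  also have "\<dots> = of_real (norm_sq n d \<phi>)"
    by (simp only: norm_sq_def cnj_mult_self of_real_sum)
  finally show ?thesis .
qed

lemma braket_self: "braket n d \<phi> \<phi> = of_real (norm_sq n d \<phi>)"
  by (simp only: braket_def norm_sq_def cnj_mult_self of_real_sum)

lemma locc_projection_onto_product_state:
  assumes "product_state n d \<eta>"
  shows "locc_implementable n d
    (\<lambda>x a b. if x then \<eta> a * cnj (\<eta> b) else (if a = b then 1 else 0) - \<eta> a * cnj (\<eta> b))"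
    (is "locc_implementable n d ?M")
proof -
  obtain u where u: "\<And>k. k < n \<Longrightarrow> dim_vec (u k) = d k"
      "\<And>k. k < n \<Longrightarrow> (\<Sum>j<d k. (cmod (u k $ j))\<^sup>2) = 1"
    and \<eta>: "\<eta> = tensor n d u"
    using product_state_unit_factors[OF assms] by blast
  let ?P = "check_factors u [0..<n]"
  \<comment> \<open>Stated for arbitrary \<phi>, so that it yields both implementability on pure
    states and, as probabilities are nonnegative, positivity of the POVM.\<close>
  have prob: "sandwich n d \<phi> (?M x) \<phi> = of_real (outcome_prob n d ?P \<phi> x)" for \<phi> x
    using outcome_prob_check_all[OF u, where \<phi> = \<phi> and x = x]
    by (cases x) (simp_all add: sandwich_rank_one sandwich_one_minus \<eta>)
  have "povm n d ?M"
    unfolding povm_def prob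
    by (simp add: outcome_prob_nonneg UNIV_bool)
  moreover have "valid_protocol n d ?P"
    by (rule valid_check_factors) (auto simp: u)
  ultimately show ?thesis
    unfolding locc_implementable_def using prob by blast
qed

theorem corollary1:
  fixes n N :: nat and d :: "nat \<Rightarrow> nat" and \<psi> :: "nat \<Rightarrow> state"
  assumes "n \<ge> 2"
    and "\<And>i. i < N \<Longrightarrow> product_state n d (\<psi> i)"
    and "\<And>i j. i < N \<Longrightarrow> j < N \<Longrightarrow> i \<noteq> j \<Longrightarrow> braket n d (\<psi> i) (\<psi> j) = 0"
  shows "complete_LRA n d N \<psi>"
proof -
  have "perfectly_answerable n d N \<psi> i" if i: "i < N" for i
    unfolding perfectly_answerable_def
  proof (intro exI conjI allI impI)
    show "locc_implementable n d (\<lambda>x a b. if x then \<psi> i a * cnj (\<psi> i b)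
        else (if a = b then 1 else 0) - \<psi> i a * cnj (\<psi> i b))"
      using assms(2)[OF i] by (rule locc_projection_onto_product_state)
  \<comment> \<open>The answer "yes" has probability equal to the squared modulus of the inner
    product with the state asked about: 1 by normalisation, and 0 on every other state by
    orthogonality.\<close>
  qed (use i assms(2)[OF i] assms(3)[of i] assms(3)[OF _ i] in
      \<open>simp_all add: sandwich_rank_one braket_self product_state_def pure_state_def\<close>)
  then show ?thesis by (simp add: complete_LRA_def)
qed

end
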